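(* There are exactly $6$ isomorphism classes of ternary $f$-quandles of order $2$. Each of them can be defined on $\mathbb{Z}_2=\mathbb{Z}/2\mathbb{Z}$ by one of the following ternary operations: $\tau(x,y,z)=x$, $\tau(x,y,z)=x+1$, $\tau(x,y,z)=x+y$, $\tau(x,y,z)=x+z$, $\tau(x,y,z)=x+y+z$, $\tau(x,y,z)=x+y+z+1$ (with twisting map $x\mapsto\tau(x,x,x)$).
   Context: A ternary $f$-quandle is a triple $(Q,T,\alpha)$ where $Q$ is a set, $T:Q\times Q\times Q\to Q$ is a ternary operation and $\alpha:Q\to Q$ is a morphism (i.e. $\alpha(T(x,y,z))=T(\alpha(x),\alpha(y),\alpha(z))$), called the twisting map, such that: (i) $T(T(x,y,z),\alpha(u),\alpha(v))=T(T(x,u,v),T(y,u,v),T(z,u,v))$ for all $x,y,z,u,v\in Q$; (ii) for all $a,b\in Q$, the map $R_{a,b}:Q\to Q$, $R_{a,b}(x)=T(x,a,b)$, is invertible; (iii) $T(x,x,x)=\alpha(x)$ for all $x\in Q$ (so $\alpha$ is determined by $T$). Its order is the cardinality of $Q$. An isomorphism from $(Q,T,\alpha)$ to $(Q',T',\alpha')$ is a bijection $\phi:Q\to Q'$ with $\phi(T(x,y,z))=T'(\phi(x),\phi(y),\phi(z))$ for all $x,y,z\in Q$. *)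

theory Defs
  imports Main "HOL-Library.Z2"
begin

text \<open>
  Structures are carried by a set; the values of the operation and of the twisting map outside
  the carrier are unconstrained and play no role.
\<close>

locale ternary_f_quandle =
  fixes Q :: "'a set"
    and T :: "'a \<Rightarrow> 'a \<Rightarrow> 'a \<Rightarrow> 'a"
    and \<alpha> :: "'a \<Rightarrow> 'a"
  assumes T_closed: "\<lbrakk>x \<in> Q; y \<in> Q; z \<in> Q\<rbrakk> \<Longrightarrow> T x y z \<in> Q"
    and twist_closed: "x \<in> Q \<Longrightarrow> \<alpha> x \<in> Q"
    and twist_morphism:
      "\<lbrakk>x \<in> Q; y \<in> Q; z \<in> Q\<rbrakk> \<Longrightarrow> \<alpha> (T x y z) = T (\<alpha> x) (\<alpha> y) (\<alpha> z)"
    and distributive: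
      "\<lbrakk>x \<in> Q; y \<in> Q; z \<in> Q; u \<in> Q; v \<in> Q\<rbrakk>
        \<Longrightarrow> T (T x y z) (\<alpha> u) (\<alpha> v) = T (T x u v) (T y u v) (T z u v)"
    and right_invertible: "\<lbrakk>a \<in> Q; b \<in> Q\<rbrakk> \<Longrightarrow> bij_betw (\<lambda>x. T x a b) Q Q"
    and diagonal: "x \<in> Q \<Longrightarrow> T x x x = \<alpha> x"

type_synonym 'a ternary_structure = "'a set \<times> ('a \<Rightarrow> 'a \<Rightarrow> 'a \<Rightarrow> 'a) \<times> ('a \<Rightarrow> 'a)"

definition ternary_f_quandles_of_order :: "nat \<Rightarrow> 'a ternary_structure set" where
  "ternary_f_quandles_of_order n =
     {(Q, T, \<alpha>). ternary_f_quandle Q T \<alpha> \<and> finite Q \<and> card Q = n}"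

fun isomorphic :: "'a ternary_structure \<Rightarrow> 'b ternary_structure \<Rightarrow> bool" where
  "isomorphic (Q, T, \<alpha>) (Q', T', \<alpha>') \<longleftrightarrow>
     (\<exists>\<phi>. bij_betw \<phi> Q Q' \<and>
        (\<forall>x\<in>Q. \<forall>y\<in>Q. \<forall>z\<in>Q. \<phi> (T x y z) = T' (\<phi> x) (\<phi> y) (\<phi> z)))"

definition isomorphism_classes_of_order :: "nat \<Rightarrow> 'a ternary_structure set set" where
  "isomorphism_classes_of_order n =
     ternary_f_quandles_of_order n //
       {(A, B). A \<in> ternary_f_quandles_of_order n \<and> B \<in> ternary_f_quandles_of_order n
                \<and> isomorphic A B}"

definition on_Z2 :: "(bit \<Rightarrow> bit \<Rightarrow> bit \<Rightarrow> bit) \<Rightarrow> bit ternary_structure" where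
  "on_Z2 \<tau> = (UNIV, \<tau>, \<lambda>x. \<tau> x x x)"

definition Z2_operations :: "(bit \<Rightarrow> bit \<Rightarrow> bit \<Rightarrow> bit) list" where
  "Z2_operations =
    [\<lambda>x y z. x,
     \<lambda>x y z. x + 1,
     \<lambda>x y z. x + y,
     \<lambda>x y z. x + z,
     \<lambda>x y z. x + y + z,
     \<lambda>x y z. x + y + z + 1]"

end

theory Submission
  imports Defs
begin

text \<open>
  On a two-element set, identified with \<open>\<int>\<^sub>2\<close>, the only bijections are the translations
  \<open>x \<mapsto> x + c\<close>.  Hence invertibility of the right
  translations says exactly that \<open>T x y z = x + g y z\<close> for some function \<open>g\<close>, and every
  such \<open>g\<close> is a polynomial \<open>a + b y + c z + d y z\<close>.  The distributive law then reads
  \<open>g y z + g (\<alpha> u) (\<alpha> v) = k + g (y + k) (z + k)\<close> with \<open>k = g u v\<close>.  Unless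
  \<open>g = 0\<close>, some \<open>u\<close> and \<open>v\<close> give \<open>k = 1\<close>, and then the law makes
  \<open>g y z + g (y + 1) (z + 1)\<close> independent of \<open>y\<close> and \<open>z\<close>, whereas this sum contains the
  term \<open>d (y + z)\<close>; so \<open>g\<close> must be affine (\<open>binary_quandle_affine\<close>).
  All eight affine choices are quandles, and the only identifications among them come from
  conjugating by the one nontrivial translation, which replaces \<open>a\<close> by \<open>a + b + c\<close>: it fixes
  the operations with \<open>b = c\<close> and pairs \<open>x + y\<close> with \<open>x + y + 1\<close>, and \<open>x + z\<close> with
  \<open>x + z + 1\<close>.  This leaves six classes
  (\<open>quandle_isomorphic_to_listed\<close>, \<open>listed_isomorphic_imp_eq\<close>).

  Quandle structures are moved between an arbitrary two-element carrier and \<open>\<int>\<^sub>2\<close> by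
  transport along a bijection (\<open>quandle_isomorphic_invariant\<close>).  In particular every listed
  operation is realised inside any type with at least two elements, so counting the isomorphism
  classes there amounts to counting the listed operations.
\<close>

section \<open>Isomorphism and transport of structure\<close>

lemma isomorphic_sym:
  fixes Q :: "'a set" and Q' :: "'b set"
  assumes closed: "\<And>x y z. \<lbrakk>x \<in> Q; y \<in> Q; z \<in> Q\<rbrakk> \<Longrightarrow> T x y z \<in> Q"
    and iso: "isomorphic (Q, T, \<alpha>) (Q', T', \<alpha>')"
  shows "isomorphic (Q', T', \<alpha>') (Q, T, \<alpha>)"
proof -
  obtain \<phi> where \<phi>: "bij_betw \<phi> Q Q'"
    and hom: "\<And>x y z. \<lbrakk>x \<in> Q; y \<in> Q; z \<in> Q\<rbrakk> \<Longrightarrow> \<phi> (T x y z) = T' (\<phi> x) (\<phi> y) (\<phi> z)"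
    using iso by auto
  let ?\<psi> = "inv_into Q \<phi>"
  have \<psi>: "bij_betw ?\<psi> Q' Q" using \<phi> by (rule bij_betw_inv_into)
  have "?\<psi> (T' x y z) = T (?\<psi> x) (?\<psi> y) (?\<psi> z)" if "x \<in> Q'" "y \<in> Q'" "z \<in> Q'" for x y z
  proof -
    have mem: "?\<psi> x \<in> Q" "?\<psi> y \<in> Q" "?\<psi> z \<in> Q"
      using \<psi> that by (auto simp: bij_betw_def)
    have "T' x y z = \<phi> (T (?\<psi> x) (?\<psi> y) (?\<psi> z))"
      using hom[OF mem] that \<phi> by (simp add: bij_betw_inv_into_right)
    then show ?thesis
      using \<phi> closed[OF mem] by (simp add: bij_betw_inv_into_left)
  qed
  then show ?thesis using \<psi> by auto
qed

lemma isomorphic_trans: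
  assumes "isomorphic A B" and "isomorphic B C"
  shows "isomorphic A C"
proof -
  obtain Q T \<alpha> where A: "A = (Q, T, \<alpha>)" by (cases A)
  obtain Q' T' \<alpha>' where B: "B = (Q', T', \<alpha>')" by (cases B)
  obtain Q'' T'' \<alpha>'' where C: "C = (Q'', T'', \<alpha>'')" by (cases C)
  obtain \<phi> where \<phi>: "bij_betw \<phi> Q Q'"
    and \<phi>_hom: "\<forall>x\<in>Q. \<forall>y\<in>Q. \<forall>z\<in>Q. \<phi> (T x y z) = T' (\<phi> x) (\<phi> y) (\<phi> z)"
    using assms(1) A B by auto
  obtain \<psi> where \<psi>: "bij_betw \<psi> Q' Q''"
    and \<psi>_hom: "\<forall>x\<in>Q'. \<forall>y\<in>Q'. \<forall>z\<in>Q'. \<psi> (T' x y z) = T'' (\<psi> x) (\<psi> y) (\<psi> z)"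
    using assms(2) B C by auto
  have "bij_betw (\<psi> \<circ> \<phi>) Q Q''" using \<phi> \<psi> by (rule bij_betw_trans)
  moreover have "\<phi> x \<in> Q'" if "x \<in> Q" for x using \<phi> that by (auto simp: bij_betw_def)
  ultimately show ?thesis
    using \<phi>_hom \<psi>_hom unfolding A C isomorphic.simps by (intro exI[of _ "\<psi> \<circ> \<phi>"]) simp
qed

text \<open>
  Every axiom is an identity in \<open>T\<close> or the bijectivity of a map built from \<open>T\<close>, so all of
  them travel along a bijective homomorphism; the twisting map is carried along because it
  is the diagonal of \<open>T\<close>.
\<close>

lemma quandle_isomorphic_invariant:
  fixes Q :: "'a set" and Q' :: "'b set"
  assumes "ternary_f_quandle Q T \<alpha>"
    and iso: "isomorphic (Q, T, \<alpha>) (Q', T', \<alpha>')"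
    and diag: "\<And>x. x \<in> Q' \<Longrightarrow> \<alpha>' x = T' x x x"
  shows "ternary_f_quandle Q' T' \<alpha>'"
proof -
  interpret ternary_f_quandle Q T \<alpha> by fact
  obtain \<phi> where \<phi>: "bij_betw \<phi> Q Q'"
    and hom: "\<And>x y z. \<lbrakk>x \<in> Q; y \<in> Q; z \<in> Q\<rbrakk> \<Longrightarrow> T' (\<phi> x) (\<phi> y) (\<phi> z) = \<phi> (T x y z)"
    using iso by fastforce
  have Q': "Q' = \<phi> ` Q" using \<phi> by (simp add: bij_betw_def)
  have twist: "\<alpha>' (\<phi> x) = \<phi> (\<alpha> x)" if "x \<in> Q" for x
    using that diag[of "\<phi> x"] by (simp add: Q' hom diagonal)
  show ?thesis
  proof
    fix x y z assume "x \<in> Q'" "y \<in> Q'" "z \<in> Q'"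
    then show "T' x y z \<in> Q'" by (auto simp: Q' hom T_closed)
  next
    fix x assume "x \<in> Q'"
    then show "\<alpha>' x \<in> Q'" by (auto simp: Q' twist twist_closed)
  next
    fix x y z assume "x \<in> Q'" "y \<in> Q'" "z \<in> Q'"
    then show "\<alpha>' (T' x y z) = T' (\<alpha>' x) (\<alpha>' y) (\<alpha>' z)"
      by (auto simp: Q' hom twist T_closed twist_closed twist_morphism)
  next
    fix x y z u v assume "x \<in> Q'" "y \<in> Q'" "z \<in> Q'" "u \<in> Q'" "v \<in> Q'"
    then show "T' (T' x y z) (\<alpha>' u) (\<alpha>' v) = T' (T' x u v) (T' y u v) (T' z u v)"
      by (auto simp: Q' hom twist T_closed twist_closed distributive)
  next
    fix a b assume "a \<in> Q'" "b \<in> Q'"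
    then obtain a0 b0 where ab: "a0 \<in> Q" "b0 \<in> Q" "a = \<phi> a0" "b = \<phi> b0" by (auto simp: Q')
    have "bij_betw (\<phi> \<circ> (\<lambda>x. T x a0 b0) \<circ> inv_into Q \<phi>) Q' Q'"
      using \<phi> right_invertible[OF ab(1,2)] bij_betw_inv_into[OF \<phi>]
      by (blast intro: bij_betw_trans)
    moreover have "(\<phi> \<circ> (\<lambda>x. T x a0 b0) \<circ> inv_into Q \<phi>) x = T' x a b" if "x \<in> Q'" for x
      using that ab \<phi> by (auto simp: Q' hom bij_betw_inv_into_left)
    ultimately show "bij_betw (\<lambda>x. T' x a b) Q' Q'"
      by (simp cong: bij_betw_cong)
  next
    fix x assume "x \<in> Q'"
    then show "T' x x x = \<alpha>' x" by (simp add: diag)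
  qed
qed

lemma isomorphic_transport:
  fixes Q :: "'a set" and Q' :: "'b set"
  assumes h: "bij_betw h Q Q'"
    and T': "T' = (\<lambda>x y z. h (T (inv_into Q h x) (inv_into Q h y) (inv_into Q h z)))"
  shows "isomorphic (Q, T, \<alpha>) (Q', T', \<alpha>')"
  using h unfolding T' isomorphic.simps
  by (intro exI[of _ h]) (simp add: bij_betw_inv_into_left)

section \<open>Ternary operations on the two-element field\<close>

lemma all_bit: "(\<forall>x::bit. P x) \<longleftrightarrow> P 0 \<and> P 1"
  by (metis bit.exhaust)

lemma bit_card: "card (UNIV :: bit set) = 2"
proof -
  have "(UNIV :: bit set) = {0, 1}" using bit.exhaust by auto
  moreover have "card {0, 1 :: bit} = 2" by (subst card_insert_disjoint) simp_all
  ultimately show ?thesis by (rule ssubst)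
qed

lemma bit_bij_translation:
  fixes f :: "bit \<Rightarrow> bit"
  assumes "bij f"
  shows "f x = x + f 0"
proof -
  have "f 0 \<noteq> f 1" using assms by (auto simp: bij_def dest: injD)
  then show ?thesis by (cases x; cases "f 0"; cases "f 1") auto
qed

lemma bit_polynomial:
  fixes g :: "bit \<Rightarrow> bit \<Rightarrow> bit"
  obtains a b c d where "\<And>y z. g y z = a + b * y + c * z + d * y * z"
proof
  fix y z
  \<comment> \<open>The coefficients are the Moebius transform of the values of \<open>g\<close>.\<close>
  show "g y z = g 0 0 + (g 0 0 + g 1 0) * y + (g 0 0 + g 0 1) * z
      + (g 0 0 + g 1 0 + g 0 1 + g 1 1) * y * z"
    by (cases y; cases z; cases "g 0 0"; cases "g 0 1"; cases "g 1 0"; cases "g 1 1") simp_all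
qed

lemma binary_quandle_affine:
  assumes "ternary_f_quandle (UNIV :: bit set) T \<alpha>"
  obtains a b c where "T = (\<lambda>x y z. x + a + b * y + c * z)"
proof -
  interpret ternary_f_quandle "UNIV :: bit set" T \<alpha> by fact
  obtain a b c d where g: "\<And>y z. T 0 y z = a + b * y + c * z + d * y * z"
    using bit_polynomial[of "T 0"] by blast
  have T: "T x y z = x + T 0 y z" for x y z
    using bit_bij_translation[of "\<lambda>x. T x y z" x] right_invertible[of y z] by simp
  have "d = 0"
  proof (rule ccontr)
    assume "d \<noteq> 0"
    then have d: "d = 1" by simp
    \<comment> \<open>A multilinear polynomial with a nonzero coefficient is not the zero function.\<close>
    obtain u v where uv: "T 0 u v = 1"
    proof -
      have "\<not> (\<forall>y z. T 0 y z = 0)"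
        unfolding all_bit g d by (cases a; cases b; cases c) simp_all
      then show thesis using that by auto
    qed
    have shift: "T 0 y z + T 0 (\<alpha> u) (\<alpha> v) = 1 + T 0 (y + 1) (z + 1)" for y z
    proof -
      have "T (T 0 y z) (\<alpha> u) (\<alpha> v) = T (T 0 u v) (T y u v) (T z u v)"
        by (simp add: distributive)
      then show ?thesis
        by (simp add: T[of "T 0 y z"] T[of y u v] T[of z u v] T[of 1] uv)
    qed
    show False
      using shift[of 0 0] shift[of 0 1] unfolding g d
      by (cases a; cases b; cases c) simp_all
  qed
  then have "T x y z = x + a + b * y + c * z" for x y z
    unfolding T[of x y z] g[of y z] by (simp only: add.assoc mult_zero_left add_0_right)
  then show thesis using that by blast
qed

section \<open>The six listed operations\<close>

lemma listed_is_quandle: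
  assumes "\<tau> \<in> set Z2_operations"
  shows "on_Z2 \<tau> \<in> ternary_f_quandles_of_order 2"
proof -
  have "ternary_f_quandle UNIV \<tau> (\<lambda>x. \<tau> x x x)"
  proof
    fix a b :: bit
    have "inj (\<lambda>x. \<tau> x a b)"
    proof (rule injI)
      fix x y assume "\<tau> x a b = \<tau> y a b"
      then show "x = y"
        using assms by (cases x; cases y; cases a; cases b) (auto simp: Z2_operations_def)
    qed
    moreover have "finite (UNIV :: bit set)"
      using bit_card by (intro card_ge_0_finite) simp
    ultimately show "bij_betw (\<lambda>x. \<tau> x a b) UNIV UNIV"
      by (simp add: bij_def finite_UNIV_inj_surj)
  next
    fix x y z :: bit
    show "\<tau> (\<tau> x y z) (\<tau> x y z) (\<tau> x y z) = \<tau> (\<tau> x x x) (\<tau> y y y) (\<tau> z z z)"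
      using assms by (cases x; cases y; cases z) (auto simp: Z2_operations_def)
  next
    fix x y z u v :: bit
    show "\<tau> (\<tau> x y z) (\<tau> u u u) (\<tau> v v v) = \<tau> (\<tau> x u v) (\<tau> y u v) (\<tau> z u v)"
      using assms by (cases x; cases y; cases z; cases u; cases v) (auto simp: Z2_operations_def)
  qed simp_all
  moreover have "finite (UNIV :: bit set)"
    using bit_card by (intro card_ge_0_finite) simp
  ultimately show ?thesis
    by (simp add: ternary_f_quandles_of_order_def on_Z2_def bit_card)
qed

text \<open>
  An isomorphism is a translation by \<open>c\<close>.  For \<open>c = 0\<close> the operations agree; for \<open>c = 1\<close>
  the conjugate of a listed operation is either itself or not listed.
\<close>

lemma listed_isomorphic_imp_eq:
  assumes "\<sigma> \<in> set Z2_operations" and "\<tau> \<in> set Z2_operations"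
    and "isomorphic (on_Z2 \<sigma>) (on_Z2 \<tau>)"
  shows "\<sigma> = \<tau>"
proof -
  obtain \<phi> where "bij \<phi>" and hom: "\<forall>x y z. \<phi> (\<sigma> x y z) = \<tau> (\<phi> x) (\<phi> y) (\<phi> z)"
    using assms(3) by (auto simp: on_Z2_def)
  then have \<phi>: "\<phi> x = x + \<phi> 0" for x by (intro bit_bij_translation)
  show ?thesis
  proof (cases "\<phi> 0 = 0")
    case True
    then have "\<phi> x = x" for x using \<phi>[of x] by simp
    then show ?thesis using hom by (simp add: fun_eq_iff)
  next
    case False
    then have "\<phi> x = x + 1" for x using \<phi>[of x] by simp
    then have "\<forall>x y z. \<sigma> x y z + 1 = \<tau> (x + 1) (y + 1) (z + 1)" using hom by simp
    then show ?thesis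
      using assms(1,2) unfolding all_bit by (auto simp: Z2_operations_def)
  qed
qed

lemma listed_distinct: "distinct Z2_operations"
  by (simp add: Z2_operations_def fun_eq_iff all_bit)

lemma quandle_isomorphic_to_listed:
  fixes A :: "'a ternary_structure"
  assumes "A \<in> ternary_f_quandles_of_order 2"
  obtains \<tau> where "\<tau> \<in> set Z2_operations" and "isomorphic A (on_Z2 \<tau>)"
proof -
  obtain Q T \<alpha> where A: "A = (Q, T, \<alpha>)" by (cases A)
  have quandle: "ternary_f_quandle Q T \<alpha>" and "finite Q" "card Q = 2"
    using assms by (auto simp: A ternary_f_quandles_of_order_def)
  then obtain h :: "'a \<Rightarrow> bit" where h: "bij_betw h Q UNIV"
    using finite_same_card_bij[of Q "UNIV :: bit set"] bit_card
    by (metis card.infinite zero_neq_numeral)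
  define T' where "T' = (\<lambda>x y z. h (T (inv_into Q h x) (inv_into Q h y) (inv_into Q h z)))"
  have iso: "isomorphic A (on_Z2 T')"
    unfolding A on_Z2_def by (rule isomorphic_transport[OF h T'_def])
  have "ternary_f_quandle UNIV T' (\<lambda>x. T' x x x)"
    by (rule quandle_isomorphic_invariant[OF quandle iso[unfolded A on_Z2_def]]) simp
  then obtain a b c where T': "T' = (\<lambda>x y z. x + a + b * y + c * z)"
    by (rule binary_quandle_affine)
  \<comment> \<open>The two affine operations outside the list are \<open>x + y + 1\<close> and \<open>x + z + 1\<close>.\<close>
  consider "T' \<in> set Z2_operations" | "a = 1" "b + c = 1"
  proof -
    have "T' \<in> set Z2_operations" if "\<not> (a = 1 \<and> b + c = 1)"
      using that unfolding T' Z2_operations_def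
      by (cases a; cases b; cases c) (simp_all add: fun_eq_iff all_bit)
    then show thesis using that by blast
  qed
  then show thesis
  proof cases
    case 1
    then show thesis using iso that by blast
  next
    case 2
    have bc: "b = 0 \<and> c = 1 \<or> b = 1 \<and> c = 0" using 2 by (cases b; cases c) auto
    define \<tau> where "\<tau> = (\<lambda>x y z. x + b * y + c * z)"
    have "bij (\<lambda>x::bit. x + 1)" by (rule o_bij[of "\<lambda>x. x + 1"]) (simp_all add: fun_eq_iff add.assoc)
    then have "isomorphic (on_Z2 T') (on_Z2 \<tau>)"
      unfolding on_Z2_def isomorphic.simps T' \<tau>_def all_bit ball_UNIV
      using 2 bc by (intro exI[of _ "\<lambda>x. x + 1"]) auto
    moreover have "\<tau> \<in> set Z2_operations"
      unfolding \<tau>_def Z2_operations_def using bc by (auto simp: fun_eq_iff all_bit)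
    ultimately show thesis using iso isomorphic_trans that by blast
  qed
qed

lemma listed_realised:
  assumes "\<exists>x y :: 'a. x \<noteq> y" and "\<tau> \<in> set Z2_operations"
  obtains A :: "'a ternary_structure"
  where "A \<in> ternary_f_quandles_of_order 2" and "isomorphic A (on_Z2 \<tau>)"
proof -
  obtain p q :: 'a where "p \<noteq> q" using assms(1) by blast
  define Q where "Q = {p, q}"
  have Q: "finite Q" "card Q = 2" using \<open>p \<noteq> q\<close> by (auto simp: Q_def)
  obtain h :: "bit \<Rightarrow> 'a" where h: "bij_betw h UNIV Q"
    using finite_same_card_bij[of "UNIV :: bit set" Q] bit_card Q
    by (metis card.infinite zero_neq_numeral)
  define T where "T = (\<lambda>x y z. h (\<tau> (inv h x) (inv h y) (inv h z)))"
  have iso: "isomorphic (UNIV, \<tau>, \<lambda>x. \<tau> x x x) (Q, T, \<lambda>x. T x x x)"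
    by (rule isomorphic_transport[OF h T_def])
  have "ternary_f_quandle UNIV \<tau> (\<lambda>x. \<tau> x x x)"
    using listed_is_quandle[OF assms(2)]
    by (simp add: ternary_f_quandles_of_order_def on_Z2_def)
  then have "ternary_f_quandle Q T (\<lambda>x. T x x x)"
    by (rule quandle_isomorphic_invariant[OF _ iso]) simp
  then have "(Q, T, \<lambda>x. T x x x) \<in> ternary_f_quandles_of_order 2"
    using Q by (simp add: ternary_f_quandles_of_order_def)
  moreover have "isomorphic (Q, T, \<lambda>x. T x x x) (on_Z2 \<tau>)"
    unfolding on_Z2_def by (rule isomorphic_sym[OF _ iso]) simp
  ultimately show thesis by (rule that)
qed

section \<open>Counting the isomorphism classes\<close>

lemma quandles_isomorphic_sym:
  assumes "A \<in> ternary_f_quandles_of_order n" and "isomorphic A B"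
  shows "isomorphic B A"
proof -
  obtain Q T \<alpha> where A: "A = (Q, T, \<alpha>)" by (cases A)
  obtain Q' T' \<alpha>' where B: "B = (Q', T', \<alpha>')" by (cases B)
  have "ternary_f_quandle Q T \<alpha>"
    using assms(1) by (simp add: A ternary_f_quandles_of_order_def)
  then show ?thesis
    using assms(2) unfolding A B by (blast intro: isomorphic_sym dest: ternary_f_quandle.T_closed)
qed

lemma card_quotient_of_invariant:
  assumes "f ` S = P"
  shows "card (S // {(A, B). A \<in> S \<and> B \<in> S \<and> f A = f B}) = card P"
proof -
  let ?R = "{(A, B). A \<in> S \<and> B \<in> S \<and> f A = f B}"
  have "?R `` {A} = {B \<in> S. f B = f A}" if "A \<in> S" for A using that by auto
  then have "S // ?R = (\<lambda>p. {B \<in> S. f B = p}) ` P"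
    by (simp add: quotient_def UNION_singleton_eq_range image_image flip: assms)
  moreover have "inj_on (\<lambda>p. {B \<in> S. f B = p}) P"
    using assms by (fastforce simp: inj_on_def)
  ultimately show ?thesis by (simp add: card_image)
qed

theorem mainTheorem3:
  assumes "\<exists>x y :: 'a. x \<noteq> y"
  shows "card (isomorphism_classes_of_order 2 :: 'a ternary_structure set set) = 6
    \<and> (\<forall>\<tau>\<in>set Z2_operations. on_Z2 \<tau> \<in> ternary_f_quandles_of_order 2)
    \<and> (\<forall>i<6. \<forall>j<6. i \<noteq> j \<longrightarrow>
          \<not> isomorphic (on_Z2 (Z2_operations ! i)) (on_Z2 (Z2_operations ! j)))
    \<and> (\<forall>A \<in> (ternary_f_quandles_of_order 2 :: 'a ternary_structure set).
          \<exists>!\<tau>. \<tau> \<in> set Z2_operations \<and> isomorphic A (on_Z2 \<tau>))"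
proof -
  let ?S = "ternary_f_quandles_of_order 2 :: 'a ternary_structure set"
  let ?P = "\<lambda>A \<tau>. \<tau> \<in> set Z2_operations \<and> isomorphic A (on_Z2 \<tau>)"
  have len: "length Z2_operations = 6" by (simp add: Z2_operations_def)
  have unique: "\<exists>!\<tau>. ?P A \<tau>" if A: "A \<in> ?S" for A
  proof -
    obtain \<tau> where "?P A \<tau>" using A by (blast elim: quandle_isomorphic_to_listed)
    moreover have "\<sigma> = \<tau>" if "?P A \<sigma>" "?P A \<tau>" for \<sigma> \<tau>
      using that quandles_isomorphic_sym[OF A] isomorphic_trans listed_isomorphic_imp_eq by blast
    ultimately show ?thesis by blast
  qed
  define model where "model A = (THE \<tau>. ?P A \<tau>)" for A :: "'a ternary_structure"
  have model: "?P A (model A)" if "A \<in> ?S" for A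
    unfolding model_def using unique[OF that] by (rule theI')
  have model_eq: "model A = \<tau>" if "A \<in> ?S" "?P A \<tau>" for A \<tau>
    using unique[OF that(1)] model[OF that(1)] that(2) by blast
  have "model ` ?S = set Z2_operations"
  proof (intro equalityI subsetI)
    fix \<tau> assume \<tau>: "\<tau> \<in> set Z2_operations"
    obtain A where "A \<in> ?S" "isomorphic A (on_Z2 \<tau>)"
      using listed_realised[OF assms \<tau>] by blast
    then show "\<tau> \<in> model ` ?S" using model_eq \<tau> by blast
  qed (use model in blast)
  then have "card (?S // {(A, B). A \<in> ?S \<and> B \<in> ?S \<and> model A = model B})
      = card (set Z2_operations)"
    by (rule card_quotient_of_invariant)
  moreover have "isomorphic A B \<longleftrightarrow> model A = model B" if A: "A \<in> ?S" and B: "B \<in> ?S" for A B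
  proof
    assume "isomorphic A B"
    then have "isomorphic A (on_Z2 (model B))" using model[OF B] isomorphic_trans by blast
    then show "model A = model B" using model_eq[OF A] model[OF B] by blast
  next
    assume "model A = model B"
    then have "isomorphic A (on_Z2 (model B))" using model[OF A] by simp
    moreover have "isomorphic (on_Z2 (model B)) B"
      using model[OF B] quandles_isomorphic_sym[OF B] by blast
    ultimately show "isomorphic A B" by (rule isomorphic_trans)
  qed
  then have "{(A, B). A \<in> ?S \<and> B \<in> ?S \<and> isomorphic A B}
      = {(A, B). A \<in> ?S \<and> B \<in> ?S \<and> model A = model B}"
    by blast
  ultimately have "card (isomorphism_classes_of_order 2 :: 'a ternary_structure set set) = 6"
    using listed_distinct len by (simp add: isomorphism_classes_of_order_def distinct_card)
  moreover have "\<not> isomorphic (on_Z2 (Z2_operations ! i)) (on_Z2 (Z2_operations ! j))"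
    if "i < 6" "j < 6" "i \<noteq> j" for i j
    using that listed_isomorphic_imp_eq listed_distinct len
    by (metis nth_eq_iff_index_eq nth_mem)
  ultimately show ?thesis using listed_is_quandle unique by blast
qed

end
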